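(* Let $a\in\mathbb{R}$, $b\in\mathbb{N}_{a+2}$ and $0<\nu<1$. The Green's function for the boundary value problem $$\nabla\nabla_{a*}^{\nu}x(t+1)=0\ \ (t\in\mathbb{N}_{a+1}^{b-1}),\qquad x(a)=x(b)=0,$$ given for $t,s\in\mathbb{N}_a^b$ by $$G(t,s)=\begin{cases}-\dfrac{(b-s)^{\overline{\nu}}(t-a)^{\overline{\nu}}}{\Gamma(1+\nu)(b-a)^{\overline{\nu}}},& a\le t\le s\le b,\\[2ex] -\dfrac{(b-s)^{\overline{\nu}}(t-a)^{\overline{\nu}}}{\Gamma(1+\nu)(b-a)^{\overline{\nu}}}+\dfrac{(t-s)^{\overline{\nu}}}{\Gamma(1+\nu)},& a\le s\le t\le b,\end{cases}$$ satisfies the following inequalities. For all $t\in\mathbb{N}_a^b$ (and, in (1) and (2), all $s\in\mathbb{N}_a^b$): (1) $G(t,s)\le 0$; (2) $G(t,s)\ge -\left(\dfrac{b-a}{4}\right)\left(\dfrac{\Gamma(b-a+1)}{\Gamma(\nu+1)\Gamma(b-a+\nu)}\right)$; (3) $\displaystyle\int_a^b|G(t,s)|\,\nabla s\le\frac{(b-a)^2}{4\Gamma(\nu+2)}$; and for all $t\in\mathbb{N}_{a+1}^b$: (4) $\displaystyle\int_a^b|\nabla G(t,s)|\,\nabla s\le\frac{b-a}{\nu+1}$, where $\nabla$ acts on $G$ in the variable $t$.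
   Context: For $a\in\mathbb{R}$, $\mathbb{N}_a=\{a,a+1,a+2,\dots\}$, and for $b\in\mathbb{N}_a$, $\mathbb{N}_a^b=\{a,a+1,\dots,b\}$. The nabla difference is $\nabla f(t)=f(t)-f(t-1)$; in particular $\nabla G(t,s)=G(t,s)-G(t-1,s)$. The definite nabla integral is $\int_c^d f(s)\nabla s=\sum_{s=c+1}^d f(s)$ if $c<d$, and $0$ if $d\le c$. The generalized rising function is $t^{\overline{\mu}}=\Gamma(t+\mu)/\Gamma(t)$, with the convention $t^{\overline{\mu}}=0$ if $t$ is a non-positive integer and $t+\mu$ is not a non-positive integer (so $0^{\overline{\nu}}=0$). For $0<\nu<1$ the Caputo nabla fractional difference based at $a$ is $\nabla_{a*}^{\nu}x(t)=\sum_{\tau=a+1}^{t}\frac{(t-\tau+1)^{\overline{-\nu}}}{\Gamma(1-\nu)}\nabla x(\tau)$ (empty sums are $0$). The Green's function of the boundary value problem in the claim is the explicit function $G$ displayed there; the claim's inequalities concern this function. *)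

theory Defs
  imports "HOL-Analysis.Analysis"
begin

definition nats_from :: "real \<Rightarrow> real set" where
  "nats_from a = {a + real k | k. True}"

definition nats_between :: "real \<Rightarrow> real \<Rightarrow> real set" where
  "nats_between a b = {t \<in> nats_from a. t \<le> b}"

(* Sums over these sets are never degenerate because of infinite index sets. *)
lemma finite_nats_between: "finite (nats_between a b)"
proof (rule finite_subset)
  show "nats_between a b \<subseteq> (\<lambda>k. a + real k) ` {..nat \<lfloor>b - a\<rfloor>}"
    by (auto simp: nats_between_def nats_from_def le_nat_iff le_floor_iff)
qed simp

definition nabla :: "(real \<Rightarrow> real) \<Rightarrow> real \<Rightarrow> real" where
  "nabla f t = f t - f (t - 1)"

definition nabla_integral :: "real \<Rightarrow> real \<Rightarrow> (real \<Rightarrow> real) \<Rightarrow> real" where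
  "nabla_integral c d f = (if c < d then \<Sum>s\<in>nats_between (c + 1) d. f s else 0)"

(* The set \<int>\<^sub>\<le>\<^sub>0 consists of the non-positive integers. If both t and t + \<mu> lie in it, the
   function is mathematically undefined; the quotient is then 0 / 0 = 0. *)
definition rising :: "real \<Rightarrow> real \<Rightarrow> real" where
  "rising t \<mu> = (if t \<in> \<int>\<^sub>\<le>\<^sub>0 \<and> t + \<mu> \<notin> \<int>\<^sub>\<le>\<^sub>0 then 0 else Gamma (t + \<mu>) / Gamma t)"

(* Meaningful for t, s in nats_between a b. The two branches agree for t = s, where
   rising 0 \<nu> = 0. *)
definition green :: "real \<Rightarrow> real \<Rightarrow> real \<Rightarrow> real \<Rightarrow> real \<Rightarrow> real" where
  "green \<nu> a b t s =
     (if t \<le> s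
      then - (rising (b - s) \<nu> * rising (t - a) \<nu> / (Gamma (1 + \<nu>) * rising (b - a) \<nu>))
      else - (rising (b - s) \<nu> * rising (t - a) \<nu> / (Gamma (1 + \<nu>) * rising (b - a) \<nu>))
           + rising (t - s) \<nu> / Gamma (1 + \<nu>))"

end

theory Submission
  imports Defs
begin

text \<open>
  With \<open>N = b - a\<close>, \<open>t = a + m\<close> and \<open>s = a + k\<close>, everything is a statement about the
  sequence \<open>r n = rising n \<nu>\<close> on the naturals, which satisfies \<open>r 0 = 0\<close> and
  \<open>n * r (n + 1) = (n + \<nu>) * r n\<close>. The recursion shows that \<open>r (n - k) / r n\<close> increases
  in \<open>n\<close>, that the differences of \<open>r\<close> decrease from \<open>Gamma (1 + \<nu>) \<le> 1\<close>, and that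
  \<open>(\<nu> + 1) * (\<Sum>j<n. r j) = (n - 1) * r n\<close>. The first fact gives the sign of \<open>G\<close>; by the
  second, \<open>- G\<close> is maximal in \<open>t\<close> at \<open>t = s\<close>; the third evaluates both integrals.
\<close>

section \<open>Preliminary inequalities and a reindexing of sums\<close>

text \<open>The logarithm of \<open>Gamma\<close> is convex on the positive reals and vanishes at 1
  and 2, hence is nonpositive in between.\<close>

lemma Gamma_one_plus_le_one:
  fixes \<nu> :: real
  assumes "0 < \<nu>" "\<nu> < 1"
  shows "Gamma (1 + \<nu>) \<le> 1"
proof -
  have "ln (Gamma ((1 - \<nu>) *\<^sub>R 1 + \<nu> *\<^sub>R (2::real))) \<le> (1 - \<nu>) * ln (Gamma 1) + \<nu> * ln (Gamma (2::real))"
    using log_convex_Gamma_real assms unfolding o_def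
    by (intro convex_onD) auto
  also have "\<dots> = 0"
    using Gamma_fact[of 1, where ?'a = real] by (simp add: numeral_2_eq_2)
  finally have "ln (Gamma (1 + \<nu>)) \<le> 0"
    by (simp add: algebra_simps)
  then show ?thesis
    using assms by (simp add: Gamma_real_pos)
qed

text \<open>Source of the factor 4 in the bounds (2) and (3).\<close>

lemma nat_mult_diff_le_quarter_square:
  fixes k n :: nat
  assumes "k \<le> n"
  shows "real k * real (n - k) \<le> (real n)\<^sup>2 / 4"
proof -
  have "0 \<le> (real n - 2 * real k)\<^sup>2"
    by simp
  then show ?thesis
    using assms by (simp add: of_nat_diff power2_eq_square algebra_simps)
qed

text \<open>For \<open>k \<ge> m\<close> truncated subtraction gives \<open>f 0 = 0\<close>; the
  remaining terms form the right-hand sum in reverse order.\<close>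

lemma sum_diff_eq_sum_lessThan:
  fixes f :: "nat \<Rightarrow> 'a::comm_monoid_add"
  assumes "f 0 = 0" "m \<le> n"
  shows "(\<Sum>k=1..n. f (m - k)) = (\<Sum>j<m. f j)"
proof -
  have "(\<Sum>k=1..n. f (m - k)) = (\<Sum>k=1..m. f (m - k))"
    using assms by (intro sum.mono_neutral_right) auto
  also have "\<dots> = (\<Sum>j<m. f j)"
    by (rule sum.reindex_bij_witness[of _ "\<lambda>j. m - j" "\<lambda>k. m - k"]) auto
  finally show ?thesis .
qed

section \<open>The rising function as a sequence\<close>

locale fractional_order =
  fixes \<nu> :: real
  assumes order_pos: "0 < \<nu>" and order_less_one: "\<nu> < 1"
begin

definition r :: "nat \<Rightarrow> real" where
  "r n = rising (real n) \<nu>"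

definition d :: "nat \<Rightarrow> real" where
  "d n = r (Suc n) - r n"

lemma Gamma_pos: "Gamma (1 + \<nu>) > 0"
  using order_pos by (intro Gamma_real_pos) simp

lemma r_0 [simp]: "r 0 = 0"
  by (simp add: r_def rising_def)

lemma r_eq: "n > 0 \<Longrightarrow> r n = Gamma (real n + \<nu>) / Gamma (real n)"
  by (auto simp: r_def rising_def elim!: nonpos_Ints_cases)

lemma r_1: "r (Suc 0) = Gamma (1 + \<nu>)"
  by (simp add: r_eq)

lemma r_pos: "n > 0 \<Longrightarrow> r n > 0"
  using order_pos by (simp add: r_eq Gamma_real_pos)

lemma r_nonneg [simp]: "r n \<ge> 0"
  using r_pos[of n] by (cases n) auto

lemma r_Suc: "real n * r (Suc n) = (real n + \<nu>) * r n"
proof (cases "n = 0")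
  case False
  have "Gamma (real n + \<nu> + 1) = (real n + \<nu>) * Gamma (real n + \<nu>)"
    using False order_pos by (intro Gamma_plus1) (auto elim!: nonpos_Ints_cases)
  moreover have "Gamma (real n + 1) = real n * Gamma (real n)"
    using False by (intro Gamma_plus1) (auto elim!: nonpos_Ints_cases)
  moreover have "Gamma (real n) > 0"
    using False by (intro Gamma_real_pos) simp
  ultimately show ?thesis
    using False by (simp add: r_eq add_ac)
qed simp

lemma d_eq: "real n * d n = \<nu> * r n"
  using r_Suc[of n] by (simp add: d_def algebra_simps)

lemma d_nonneg [simp]: "d n \<ge> 0"
proof (cases "n = 0")
  case False
  then have "real n * d n \<ge> 0" "real n > 0"
    using order_pos by (auto simp: d_eq)
  then show ?thesis
    by (simp add: zero_le_mult_iff)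
qed (use r_pos[of 1] in \<open>simp add: d_def\<close>)

lemma r_mono: "m \<le> n \<Longrightarrow> r m \<le> r n"
  by (rule lift_Suc_mono_le[of r]) (use d_nonneg in \<open>auto simp: d_def\<close>)

text \<open>Taking differences in \<open>d_eq\<close> gives
  \<open>(n + 1) * d (n + 1) = (n + \<nu>) * d n\<close>, and \<open>\<nu> < 1\<close>.\<close>

lemma d_Suc_le: "d (Suc n) \<le> d n"
proof -
  have "real (Suc n) * d (Suc n) = (real n + \<nu>) * d n"
    using d_eq[of "Suc n"] d_eq[of n] by (simp add: d_def[of n] algebra_simps)
  also have "\<dots> \<le> real (Suc n) * d n"
    using order_less_one by (intro mult_right_mono) auto
  finally show ?thesis
    by (simp del: of_nat_Suc)
qed

lemma d_antimono: "m \<le> n \<Longrightarrow> d n \<le> d m"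
  by (rule lift_Suc_antimono_le[of d]) (auto simp: d_Suc_le)

lemma d_le_Gamma: "d n \<le> Gamma (1 + \<nu>)"
  using d_antimono[of 0 n] by (simp add: d_def r_1)

lemma r_le_Gamma: "r n \<le> real n * Gamma (1 + \<nu>)"
proof (induction n)
  case (Suc n)
  then show ?case
    using d_le_Gamma[of n] by (simp add: d_def algebra_simps)
qed simp

lemma r_le: "r n \<le> real n"
  using r_le_Gamma[of n] Gamma_one_plus_le_one[OF order_pos order_less_one]
    mult_left_mono[of "Gamma (1 + \<nu>)" 1 "real n"] by linarith

text \<open>Cross-multiplied form of the monotonicity of \<open>r (n - k) / r n\<close> in
  \<open>n\<close>, which avoids dividing by \<open>r 0 = 0\<close>. For \<open>k \<ge> m\<close>
  the left side vanishes.\<close>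

lemma r_ratio_mono:
  assumes "m \<le> n"
  shows "r (m - k) * r n \<le> r (n - k) * r m"
  using assms
proof (induction n rule: dec_induct)
  case base
  show ?case by simp
next
  case (step n)
  show ?case
  proof (cases "k < m")
    case True
    then have n: "k < n" "0 < n" and Suc: "Suc n - k = Suc (n - k)"
      using step by auto
    \<comment> \<open>Splitting \<open>n + \<nu>\<close> as \<open>(n - k + \<nu>) + k\<close> lets
      the recursion act at \<open>n - k\<close>.\<close>
    have "(real n + \<nu>) * r (n - k) = real (n - k) * r (Suc n - k) + real k * r (n - k)"
      using r_Suc[of "n - k"] n by (simp add: Suc of_nat_diff algebra_simps)
    also have "\<dots> \<le> real (n - k) * r (Suc n - k) + real k * r (Suc n - k)"
      by (intro add_left_mono mult_left_mono r_mono) auto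
    also have "\<dots> = real n * r (Suc n - k)"
      using n by (simp add: of_nat_diff algebra_simps)
    finally have *: "(real n + \<nu>) * r (n - k) \<le> real n * r (Suc n - k)" .
    have "real n * (r (m - k) * r (Suc n)) = (real n + \<nu>) * (r (m - k) * r n)"
      using r_Suc[of n] by (metis mult.left_commute)
    also have "\<dots> \<le> (real n + \<nu>) * (r (n - k) * r m)"
      using step.IH order_pos by (intro mult_left_mono) auto
    also have "\<dots> \<le> real n * (r (Suc n - k) * r m)"
      using mult_right_mono[OF * r_nonneg[of m]] by (simp add: mult_ac)
    finally show ?thesis
      using n by simp
  qed simp
qed

text \<open>The induction step is the recursion: \<open>(n - 1) * r n + (\<nu> + 1) * r n = (n +
  \<nu>) * r n = n * r (n + 1)\<close>.\<close>

lemma sum_r: "(\<nu> + 1) * (\<Sum>j<n. r j) = (real n - 1) * r n"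
proof (induction n)
  case (Suc n)
  then show ?case
    using r_Suc[of n] by (simp add: algebra_simps)
qed simp

section \<open>Pointwise bounds for the Green's function\<close>

text \<open>Truncated subtraction and \<open>r 0 = 0\<close> merge the two branches of \<open>green\<close>.\<close>

definition kernel :: "nat \<Rightarrow> nat \<Rightarrow> nat \<Rightarrow> real" where
  "kernel n m k = r (n - k) * r m / r n - r (m - k)"

lemma green_eq_kernel:
  assumes "m \<le> n" "k \<le> n"
  shows "green \<nu> a (a + real n) (a + real m) (a + real k) = - kernel n m k / Gamma (1 + \<nu>)"
proof -
  have "rising (real n - real k) \<nu> = r (n - k)"
    using assms by (simp add: r_def of_nat_diff)
  \<comment> \<open>Restricted to \<open>k < m\<close>, where truncated and real subtraction agree;
    otherwise the first branch of \<open>green\<close> applies.\<close>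
  moreover have "k < m \<Longrightarrow> rising (real m - real k) \<nu> = r (m - k)"
    by (simp add: r_def of_nat_diff)
  moreover have "rising (real n) \<nu> = r n" "rising (real m) \<nu> = r m"
    by (simp_all add: r_def)
  ultimately show ?thesis
    by (auto simp: green_def kernel_def diff_divide_distrib mult_ac)
qed

lemma kernel_nonneg:
  assumes "m \<le> n"
  shows "0 \<le> kernel n m k"
proof (cases "n = 0")
  case False
  then show ?thesis
    using r_ratio_mono[OF assms, of k] r_pos[of n] by (simp add: kernel_def pos_le_divide_eq)
qed (use assms in \<open>simp add: kernel_def\<close>)

text \<open>Since \<open>r (n - k) \<le> r n\<close> and \<open>d\<close> decreases. From
  \<open>m = k\<close> on, this makes the kernel nonincreasing in \<open>m\<close>.\<close>

lemma scaled_d_le: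
  assumes "k \<le> m" "k \<le> n" "0 < n"
  shows "r (n - k) * d m / r n \<le> d (m - k)"
proof -
  have "r (n - k) * d m \<le> r n * d (m - k)"
    by (intro mult_mono r_mono d_antimono) auto
  then show ?thesis
    using r_pos[OF assms(3)] by (simp add: pos_divide_le_eq mult_ac)
qed

lemma kernel_Suc_diff:
  "kernel n (Suc m) k - kernel n m k = r (n - k) * d m / r n - (r (Suc m - k) - r (m - k))"
  by (simp add: kernel_def d_def diff_divide_distrib right_diff_distrib)

text \<open>Up to \<open>m = k\<close> the subtracted term is zero and the kernel grows with
  \<open>r m\<close>; beyond that \<open>scaled_d_le\<close> makes it fall.\<close>

lemma kernel_le_diagonal:
  assumes "m \<le> n" "k \<le> n" "0 < n"
  shows "kernel n m k \<le> kernel n k k"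
proof (cases "m \<le> k")
  case True
  then show ?thesis
    using r_pos[OF assms(3)]
    by (simp add: kernel_def divide_right_mono mult_left_mono r_mono)
next
  case False
  then have "k \<le> m" by simp
  then show ?thesis
  proof (induction m rule: dec_induct)
    case (step m)
    have "kernel n (Suc m) k - kernel n m k \<le> 0"
      using scaled_d_le[of k m n] step assms by (simp add: kernel_Suc_diff d_def Suc_diff_le)
    then show ?case
      using step by simp
  qed simp
qed

text \<open>On the diagonal the kernel is \<open>r (n - k) * r k / r n\<close>. Only the numerator
  is estimated, since \<open>r n\<close> supplies the Gamma quotient in (2).\<close>

lemma kernel_le:
  assumes "m \<le> n" "k \<le> n" "0 < n"
  shows "kernel n m k \<le> (real n)\<^sup>2 / 4 / r n"
proof -
  have "r (n - k) * r k \<le> real (n - k) * real k"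
    by (intro mult_mono r_le) auto
  also have "\<dots> \<le> (real n)\<^sup>2 / 4"
    using nat_mult_diff_le_quarter_square[OF assms(2)] by (simp add: mult_ac)
  finally have "kernel n k k \<le> (real n)\<^sup>2 / 4 / r n"
    unfolding kernel_def by (simp add: divide_right_mono del: divide_divide_eq_left)
  then show ?thesis
    using kernel_le_diagonal[OF assms] by linarith
qed

section \<open>Sums of the kernel and of its differences\<close>

text \<open>Both parts are reversed partial sums of \<open>r\<close>; by \<open>sum_r\<close> the
  factor \<open>r n\<close> cancels, leaving \<open>(n - 1) * r m - (m - 1) * r m\<close>.\<close>

lemma sum_kernel:
  assumes "m \<le> n" "0 < n"
  shows "(\<nu> + 1) * (\<Sum>k=1..n. kernel n m k) = r m * real (n - m)"
proof -
  have "(\<Sum>k=1..n. kernel n m k) = (\<Sum>k=1..n. r (n - k)) * r m / r n - (\<Sum>k=1..n. r (m - k))"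
    by (simp add: kernel_def sum_subtractf sum_distrib_right sum_divide_distrib)
  also have "\<dots> = (\<Sum>j<n. r j) * r m / r n - (\<Sum>j<m. r j)"
    using assms by (simp only: sum_diff_eq_sum_lessThan r_0 order_refl)
  finally have "(\<nu> + 1) * (\<Sum>k=1..n. kernel n m k)
      = ((\<nu> + 1) * (\<Sum>j<n. r j)) * r m / r n - (\<nu> + 1) * (\<Sum>j<m. r j)"
    by (simp add: right_diff_distrib)
  also have "\<dots> = (real n - 1) * r m - (real m - 1) * r m"
    using r_pos[OF assms(2)] by (simp add: sum_r)
  finally show ?thesis
    using assms by (simp add: of_nat_diff algebra_simps)
qed

lemma sum_kernel_le:
  assumes "m \<le> n" "0 < n"
  shows "(\<Sum>k=1..n. kernel n m k) \<le> (real n)\<^sup>2 / (4 * (\<nu> + 1))"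
proof -
  have "(\<nu> + 1) * (\<Sum>k=1..n. kernel n m k) \<le> real m * real (n - m)"
    unfolding sum_kernel[OF assms] by (intro mult_right_mono r_le) auto
  also have "\<dots> \<le> (real n)\<^sup>2 / 4"
    by (rule nat_mult_diff_le_quarter_square[OF assms(1)])
  finally show ?thesis
    using order_pos by (simp add: field_simps)
qed

text \<open>The difference of the kernel in \<open>m\<close> is nonpositive for \<open>k \<le> m\<close> and nonnegative for
  \<open>k > m\<close>, so its absolute value is its negative plus twice its part on \<open>k > m\<close>.\<close>

lemma sum_abs_kernel_diff_le:
  assumes "m < n"
  shows "(\<Sum>k=1..n. \<bar>kernel n (Suc m) k - kernel n m k\<bar>) \<le> Gamma (1 + \<nu>) * (real n / (\<nu> + 1))"
proof -
  define e where "e k = kernel n (Suc m) k - kernel n m k" for k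
  \<comment> \<open>The positive part of \<open>e\<close>: for \<open>k > m\<close> both
    \<open>Suc m - k\<close> and \<open>m - k\<close> are 0, so the subtracted terms vanish.\<close>
  define p where "p k = (if m < k then r (n - k) * d m / r n else 0)" for k
  have rn: "r n > 0"
    using assms by (intro r_pos) simp
  have "\<bar>e k\<bar> = 2 * p k - e k" if "k \<le> n" for k
  proof (cases "m < k")
    case True
    then have "e k = r (n - k) * d m / r n"
      by (simp add: e_def kernel_Suc_diff)
    then show ?thesis
      using True rn by (simp add: p_def)
  next
    case False
    then have "e k \<le> 0"
      using scaled_d_le[of k m n] that assms
      by (simp add: e_def kernel_Suc_diff d_def[of "m - k"] Suc_diff_le)
    then show ?thesis
      using False by (simp add: p_def)
  qed
  then have abs: "(\<Sum>k=1..n. \<bar>e k\<bar>) = 2 * (\<Sum>k=1..n. p k) - (\<Sum>k=1..n. e k)"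
    by (simp add: sum_subtractf sum_distrib_left)
  have "(\<Sum>k=1..n. e k) = (\<Sum>k=1..n. kernel n (Suc m) k) - (\<Sum>k=1..n. kernel n m k)"
    by (simp add: e_def sum_subtractf)
  then have sum_e: "(\<nu> + 1) * (\<Sum>k=1..n. e k) = r (Suc m) * real (n - Suc m) - r m * real (n - m)"
    using sum_kernel[of "Suc m" n] sum_kernel[of m n] assms by (simp add: right_diff_distrib)
  have "(\<Sum>k=1..n. p k) = (\<Sum>k=Suc m..n. r (n - k) * d m / r n)"
    by (rule sum.mono_neutral_cong_right) (auto simp: p_def)
  also have "\<dots> = (\<Sum>k=Suc m..n. r (n - k)) * d m / r n"
    by (simp add: sum_distrib_right sum_divide_distrib)
  also have "(\<Sum>k=Suc m..n. r (n - k)) = (\<Sum>j<n - m. r j)"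
    using assms by (intro sum.reindex_bij_witness[of _ "\<lambda>j. n - j" "\<lambda>k. n - k"]) auto
  finally have "(\<nu> + 1) * (\<Sum>k=1..n. p k) = ((\<nu> + 1) * (\<Sum>j<n - m. r j)) * d m / r n"
    by simp
  also have "\<dots> = (real (n - m) - 1) * d m * (r (n - m) / r n)"
    by (simp add: sum_r)
  also have "\<dots> \<le> (real (n - m) - 1) * d m * 1"
    using rn assms by (intro mult_left_mono mult_nonneg_nonneg) (auto simp: r_mono)
  finally have sum_p: "(\<nu> + 1) * (\<Sum>k=1..n. p k) \<le> (real (n - m) - 1) * d m"
    by simp
  have "(\<nu> + 1) * (\<Sum>k=1..n. \<bar>e k\<bar>)
      \<le> 2 * ((real (n - m) - 1) * d m) - (r (Suc m) * real (n - Suc m) - r m * real (n - m))"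
    unfolding abs using sum_p sum_e by (simp only: right_diff_distrib mult.left_commute[of _ 2])
  \<comment> \<open>Substituting \<open>r (Suc m) = r m + d m\<close> cancels all but one multiple
    of \<open>d m\<close>.\<close>
  also have "\<dots> = r m + d m * (real n - real m - 1)"
    using assms by (simp add: d_def of_nat_diff algebra_simps)
  \<comment> \<open>The bounds keep \<open>Gamma (1 + \<nu>)\<close> so that it cancels the
    denominator of \<open>green\<close>. They add up to
    \<open>(n - 1) * Gamma (1 + \<nu>)\<close>.\<close>
  also have "\<dots> \<le> real m * Gamma (1 + \<nu>) + Gamma (1 + \<nu>) * (real n - real m - 1)"
    using assms by (intro add_mono mult_right_mono r_le_Gamma d_le_Gamma) auto
  also have "\<dots> \<le> Gamma (1 + \<nu>) * real n"
    using Gamma_pos by (simp add: algebra_simps)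
  finally show ?thesis
    using order_pos by (simp add: e_def field_simps)
qed

end

section \<open>Passage from the real grid to natural indices\<close>

lemma nats_between_add:
  "nats_between a (a + real n) = (\<lambda>k. a + real k) ` {..n}"
  by (auto simp: nats_between_def nats_from_def)

lemma nats_between_add_one:
  "nats_between (a + 1) (a + real n) = (\<lambda>k. a + real k) ` {1..n}"
proof -
  have "nats_from (a + 1) = range (\<lambda>k. a + real (Suc k))"
    by (auto simp: nats_from_def)
  also have "\<dots> = (\<lambda>k. a + real k) ` {1..}"
    by (simp add: atLeast_Suc_greaterThan greaterThan_0 image_image)
  finally show ?thesis
    by (auto simp: nats_between_def)
qed

lemma nabla_integral_add:
  "nabla_integral a (a + real n) f = (\<Sum>k=1..n. f (a + real k))"
  unfolding nabla_integral_def nats_between_add_one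
  by (subst sum.reindex) (auto simp: inj_on_def)

theorem theorem33:
  fixes a b \<nu> :: real
  assumes "b \<in> nats_from (a + 2)" and "0 < \<nu>" and "\<nu> < 1"
  shows "(\<forall>t\<in>nats_between a b. \<forall>s\<in>nats_between a b. green \<nu> a b t s \<le> 0) \<and>
    (\<forall>t\<in>nats_between a b. \<forall>s\<in>nats_between a b.
       green \<nu> a b t s \<ge>
         - (((b - a) / 4) * (Gamma (b - a + 1) / (Gamma (\<nu> + 1) * Gamma (b - a + \<nu>))))) \<and>
    (\<forall>t\<in>nats_between a b.
       nabla_integral a b (\<lambda>s. \<bar>green \<nu> a b t s\<bar>) \<le> (b - a)\<^sup>2 / (4 * Gamma (\<nu> + 2))) \<and>
    (\<forall>t\<in>nats_between (a + 1) b.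
       nabla_integral a b (\<lambda>s. \<bar>nabla (\<lambda>u. green \<nu> a b u s) t\<bar>) \<le> (b - a) / (\<nu> + 1))"
proof -
  interpret fractional_order \<nu>
    by standard (use assms in auto)
  define \<gamma> where "\<gamma> = Gamma (1 + \<nu>)"
  have \<gamma>: "\<gamma> > 0"
    using Gamma_pos by (simp add: \<gamma>_def)
  obtain n where b: "b = a + real n" and n: "0 < n"
  proof -
    from assms(1) obtain j where "b = a + 2 + real j"
      by (auto simp: nats_from_def)
    then show thesis
      by (intro that[of "j + 2"]) auto
  qed
  have green: "green \<nu> a b (a + real m) (a + real k) = - kernel n m k / \<gamma>"
    if "m \<le> n" "k \<le> n" for m k
    using green_eq_kernel[OF that] by (simp add: b \<gamma>_def)

  have "green \<nu> a b (a + real m) (a + real k) \<le> 0" if "m \<le> n" "k \<le> n" for m k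
    using kernel_nonneg[of m n k] that \<gamma> by (simp add: green)
  moreover have "green \<nu> a b (a + real m) (a + real k) \<ge>
      - (((b - a) / 4) * (Gamma (b - a + 1) / (Gamma (\<nu> + 1) * Gamma (b - a + \<nu>))))"
    if "m \<le> n" "k \<le> n" for m k
  proof -
    \<comment> \<open>Turns \<open>Gamma (n + 1) / Gamma (n + \<nu>)\<close> into
      \<open>n / r n\<close>.\<close>
    have "Gamma (real n + 1) = real n * Gamma (real n)"
      using n by (intro Gamma_plus1) (auto elim!: nonpos_Ints_cases)
    then have "(b - a) / 4 * (Gamma (b - a + 1) / (Gamma (\<nu> + 1) * Gamma (b - a + \<nu>)))
        = (real n)\<^sup>2 / 4 / r n / \<gamma>"
      using n by (simp add: b r_eq \<gamma>_def power2_eq_square add_ac mult_ac)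
    then show ?thesis
      using divide_right_mono[OF kernel_le[OF that n], of \<gamma>] \<gamma> that by (simp add: green)
  qed
  moreover have "nabla_integral a b (\<lambda>s. \<bar>green \<nu> a b (a + real m) s\<bar>) \<le> (b - a)\<^sup>2 / (4 * Gamma (\<nu> + 2))"
    if "m \<le> n" for m
  proof -
    have "nabla_integral a b (\<lambda>s. \<bar>green \<nu> a b (a + real m) s\<bar>) = (\<Sum>k=1..n. kernel n m k) / \<gamma>"
      unfolding b nabla_integral_add sum_divide_distrib
      using that kernel_nonneg[OF that] \<gamma> by (intro sum.cong) (auto simp: green[unfolded b])
    also have "\<dots> \<le> (real n)\<^sup>2 / (4 * (\<nu> + 1)) / \<gamma>"
      using sum_kernel_le[OF that n] \<gamma> by (intro divide_right_mono) auto
    also have "(real n)\<^sup>2 / (4 * (\<nu> + 1)) / \<gamma> = (real n)\<^sup>2 / (4 * Gamma (\<nu> + 2))"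
    proof -
      have "Gamma (\<nu> + 2) = (\<nu> + 1) * \<gamma>"
        using Gamma_plus1[of "\<nu> + 1"] assms(2) nonpos_Ints_nonpos[of "\<nu> + 1"]
        by (auto simp: \<gamma>_def add_ac)
      then show ?thesis
        by simp
    qed
    finally show ?thesis
      by (simp add: b)
  qed
  moreover have "nabla_integral a b (\<lambda>s. \<bar>nabla (\<lambda>u. green \<nu> a b u s) (a + real m)\<bar>) \<le> (b - a) / (\<nu> + 1)"
    if m: "1 \<le> m" "m \<le> n" for m
  proof -
    \<comment> \<open>\<open>nabla\<close> also evaluates at \<open>t - 1 = a + real p\<close>,
      which is a grid point because \<open>m \<ge> 1\<close>.\<close>
    obtain p where p: "m = Suc p"
      using m by (cases m) auto
    have "nabla_integral a b (\<lambda>s. \<bar>nabla (\<lambda>u. green \<nu> a b u s) (a + real m)\<bar>)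
        = (\<Sum>k=1..n. \<bar>kernel n (Suc p) k - kernel n p k\<bar> / \<gamma>)"
      unfolding b nabla_integral_add
    proof (intro sum.cong refl)
      fix k assume "k \<in> {1..n}"
      then have "nabla (\<lambda>u. green \<nu> a b u (a + real k)) (a + real m)
          = - ((kernel n (Suc p) k - kernel n p k) / \<gamma>)"
        using that green[of m k] green[of p k] by (simp add: nabla_def p diff_divide_distrib)
      then show "\<bar>nabla (\<lambda>u. green \<nu> a (a + real n) u (a + real k)) (a + real m)\<bar>
          = \<bar>kernel n (Suc p) k - kernel n p k\<bar> / \<gamma>"
        using \<gamma> by (simp add: b)
    qed
    also have "\<dots> = (\<Sum>k=1..n. \<bar>kernel n (Suc p) k - kernel n p k\<bar>) / \<gamma>"
      by (simp add: sum_divide_distrib)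
    also have "\<dots> \<le> \<gamma> * (real n / (\<nu> + 1)) / \<gamma>"
      using sum_abs_kernel_diff_le[of p n] that \<gamma>
      by (intro divide_right_mono) (auto simp: p \<gamma>_def)
    finally show ?thesis
      using \<gamma> by (simp add: b)
  qed
  moreover have "nats_between a b = (\<lambda>k. a + real k) ` {..n}"
    "nats_between (a + 1) b = (\<lambda>k. a + real k) ` {1..n}"
    by (simp_all only: b nats_between_add nats_between_add_one)
  ultimately show ?thesis
    by simp
qed

end
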